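(* Let $G$ be a bipartite edge-magic simple graph with stable sets $X$ and $Y$, suppose $G\cong H_1\oplus H_2$ is a decomposition of $G$, and let $n\ge1$. Then $|\tau_{S_{2n}(G;H_1,H_2)}|\ge (n+1)|\tau_G|+2$.
   Context: For a $(p,q)$-graph $G$ ($p$ vertices, $q$ edges), an edge-magic labeling is a bijection $f:V(G)\cup E(G)\to[1,p+q]$ such that $f(x)+f(xy)+f(y)$ equals a constant (the valence) for every edge $xy$. For a graph $H$, $\tau_H$ is the set of integers that are valences of edge-magic labelings of $H$. A decomposition $G\cong H_1\oplus H_2$ means $H_1,H_2$ are subgraphs of $G$ whose edge sets partition $E(G)$. Writing $X=\{x_i\}_{i=1}^s$, $Y=\{y_j\}_{j=1}^t$, $S_{2n}(G;H_1,H_2)$ is the graph with vertex set $X\cup Y\cup\bigcup_{k=1}^n X_k\cup\bigcup_{k=1}^n Y_k$, where $X_k=\{x_i^k\}_{i=1}^s$, $Y_k=\{y_j^k\}_{j=1}^t$ are new vertices, and edge set $E(G)\cup\{x_iy_j^k: x_iy_j\in E(H_1),\,k\in[1,n]\}\cup\{x_i^ky_j: x_iy_j\in E(H_2),\,k\in[1,n]\}$. *)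

theory Defs
  imports Main
begin

definition simple_graph :: "'a set \<Rightarrow> 'a set set \<Rightarrow> bool" where
  "simple_graph V E \<longleftrightarrow> finite V \<and>
     (\<forall>e\<in>E. \<exists>x y. x \<in> V \<and> y \<in> V \<and> x \<noteq> y \<and> e = {x, y})"

definition bipartite_with :: "'a set \<Rightarrow> 'a set set \<Rightarrow> 'a set \<Rightarrow> 'a set \<Rightarrow> bool" where
  "bipartite_with V E X Y \<longleftrightarrow> X \<union> Y = V \<and> X \<inter> Y = {} \<and>
     (\<forall>e\<in>E. \<exists>x\<in>X. \<exists>y\<in>Y. e = {x, y})"

text \<open>Labels of vertices and edges are combined in one function on the disjoint sum.
  f is an edge-magic labeling with valence k.  A valence only exists when there are edges.\<close>
definition edge_magic_labeling ::
    "'a set \<Rightarrow> 'a set set \<Rightarrow> ('a + 'a set \<Rightarrow> nat) \<Rightarrow> nat \<Rightarrow> bool" where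
  "edge_magic_labeling V E f k \<longleftrightarrow>
     bij_betw f (Inl ` V \<union> Inr ` E) {1 .. card V + card E} \<and>
     E \<noteq> {} \<and>
     (\<forall>e\<in>E. \<forall>x y. e = {x, y} \<longrightarrow> x \<noteq> y \<longrightarrow> f (Inl x) + f (Inr e) + f (Inl y) = k)"

definition valences :: "'a set \<Rightarrow> 'a set set \<Rightarrow> nat set" where
  "valences V E = {k. \<exists>f. edge_magic_labeling V E f k}"

definition edge_magic :: "'a set \<Rightarrow> 'a set set \<Rightarrow> bool" where
  "edge_magic V E \<longleftrightarrow> valences V E \<noteq> {}"

text \<open>The graph S_{2n}(G;H1,H2). Vertex (v,0) is the original vertex v, (v,k) with
  1 \<le> k \<le> n is the k-th copy v^k.\<close>
definition S2n_vertices :: "nat \<Rightarrow> 'a set \<Rightarrow> 'a set \<Rightarrow> 'a set \<Rightarrow> ('a \<times> nat) set" where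
  "S2n_vertices n V X Y = (\<lambda>v. (v, 0)) ` V \<union> X \<times> {1..n} \<union> Y \<times> {1..n}"

definition S2n_edges :: "nat \<Rightarrow> 'a set set \<Rightarrow> 'a set \<Rightarrow> 'a set \<Rightarrow> 'a set set \<Rightarrow> 'a set set
    \<Rightarrow> ('a \<times> nat) set set" where
  "S2n_edges n E X Y E1 E2 =
     (\<lambda>e. (\<lambda>v. (v, 0)) ` e) ` E
     \<union> {{(x, 0), (y, k)} | x y k. x \<in> X \<and> y \<in> Y \<and> {x, y} \<in> E1 \<and> k \<in> {1..n}}
     \<union> {{(x, k), (y, 0)} | x y k. x \<in> X \<and> y \<in> Y \<and> {x, y} \<in> E2 \<and> k \<in> {1..n}}"

end

theory Submission
  imports Defs
begin

text \<open>
  Every vertex and every edge of \<open>G\<close> gives rise to exactly \<open>n + 1\<close> vertices or edges of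
  \<open>S = S_{2n}(G;H_1,H_2)\<close>, indexed by \<open>0, \<dots>, n\<close>. Let \<open>N = p + q\<close> and let \<open>f\<close> be an
  edge-magic labeling of \<open>G\<close> with valence \<open>k\<close>. Giving the copies of \<open>u\<close> the labels in the block
  \<open>(n+1)(f u - 1) + {1..n+1}\<close>, with original vertices in position \<open>r\<close> and edges running through
  their block in the direction opposite to the vertices, produces the valence \<open>(n+1) k - 2 n + r\<close>;
  the \<open>n + 1\<close> choices of \<open>r\<close> yield pairwise distinct values for all \<open>k\<close>.

  For the two further valences, take the smallest valence \<open>k\<close> of \<open>G\<close> and let \<open>M\<close> be the largest
  label carried by an edge or a non-isolated vertex, so that \<open>k \<ge> M + 3\<close>. Interleaving the copies
  the other way, \<open>f u + M i\<close>, and labeling the copies of isolated vertices arbitrarily, gives the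
  valence \<open>k + M n\<close>, which lies below \<open>(n+1) k - 2 n\<close> and hence below all the previous ones.
  Its complement lies above all of them, because complementation also reverses the valences of \<open>G\<close>.
\<close>

section \<open>Edge-magic labelings\<close>

lemma simple_graph_finite_edges:
  assumes "simple_graph V E"
  shows "finite E"
proof (rule finite_subset)
  show "E \<subseteq> Pow V" using assms by (auto simp: simple_graph_def)
  show "finite (Pow V)" using assms by (simp add: simple_graph_def)
qed

lemma card_graph_elements:
  assumes "finite V" "finite E"
  shows "card (Inl ` V \<union> Inr ` E) = card V + card E"
  using card_Plus[OF assms] by (simp add: Plus_def)

lemma edge_magic_labeling_range:
  assumes "edge_magic_labeling V E f k" "u \<in> Inl ` V \<union> Inr ` E"
  shows "1 \<le> f u" "f u \<le> card V + card E"
  using assms unfolding edge_magic_labeling_def bij_betw_def by fastforce+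

text \<open>Each of the three summands is at most the number of vertices and edges. The bound makes
  the set of valences finite, so that its cardinality counts, and keeps later natural subtractions
  from truncating.\<close>

lemma valences_le:
  assumes "simple_graph V E" "k \<in> valences V E"
  shows "k \<le> 3 * (card V + card E)"
proof -
  obtain f where f: "edge_magic_labeling V E f k"
    using assms(2) by (auto simp: valences_def)
  then obtain e where "e \<in> E" by (auto simp: edge_magic_labeling_def)
  moreover from this obtain x y where "x \<in> V" "y \<in> V" "x \<noteq> y" "e = {x, y}"
    using assms(1) by (auto simp: simple_graph_def)
  ultimately show ?thesis
    using f edge_magic_labeling_range(2)[OF f, of "Inl x"]
      edge_magic_labeling_range(2)[OF f, of "Inl y"]
      edge_magic_labeling_range(2)[OF f, of "Inr e"]
    by (fastforce simp: edge_magic_labeling_def)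
qed

lemma finite_valences:
  assumes "simple_graph V E"
  shows "finite (valences V E)"
  using valences_le[OF assms] by (meson finite_nat_set_iff_bounded_le)

text \<open>Reversing the order of the labels, \<open>i\<close> to \<open>T + 1 - i\<close>,
  permutes \<open>{1..T}\<close> and acts on all three summands of an edge sum.\<close>

lemma valences_complement:
  assumes "simple_graph V E" "k \<in> valences V E"
  shows "3 * (card V + card E + 1) - k \<in> valences V E"
proof -
  define T where "T = card V + card E"
  obtain f where f: "edge_magic_labeling V E f k"
    using assms(2) by (auto simp: valences_def)
  define g where "g u = T + 1 - f u" for u
  have "bij_betw (\<lambda>i. T + 1 - i) {1..T} {1..T}"
    by (rule bij_betw_byWitness[where f' = "\<lambda>i. T + 1 - i"]) auto
  moreover have "bij_betw f (Inl ` V \<union> Inr ` E) {1..T}"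
    using f by (simp add: edge_magic_labeling_def T_def)
  ultimately have "bij_betw ((\<lambda>i. T + 1 - i) \<circ> f) (Inl ` V \<union> Inr ` E) {1..T}"
    by (rule bij_betw_trans[rotated])
  then have "bij_betw g (Inl ` V \<union> Inr ` E) {1..T}"
    by (simp add: g_def[abs_def] comp_def)
  moreover have "g (Inl x) + g (Inr e) + g (Inl y) = 3 * (T + 1) - k"
    if "e \<in> E" "e = {x, y}" "x \<noteq> y" for e x y
  proof -
    have "x \<in> V" "y \<in> V"
      using assms(1) that by (auto simp: simple_graph_def doubleton_eq_iff)
    moreover have "f (Inl x) + f (Inr e) + f (Inl y) = k"
      using f that by (auto simp: edge_magic_labeling_def)
    ultimately show ?thesis
      using that edge_magic_labeling_range(2)[OF f, of "Inl x"]
        edge_magic_labeling_range(2)[OF f, of "Inl y"]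
        edge_magic_labeling_range(2)[OF f, of "Inr e"]
      by (auto simp: g_def T_def)
  qed
  ultimately have "edge_magic_labeling V E g (3 * (T + 1) - k)"
    using f by (auto simp: edge_magic_labeling_def T_def)
  then show ?thesis by (auto simp: valences_def T_def)
qed

text \<open>Recovers block and position from a label; both injectivity proofs for labelings of the
  split graph rest on it.\<close>

lemma quotient_remainder_unique:
  fixes a b m q q' :: nat
  assumes "a + m * q = b + m * q'" "a < m" "b < m"
  shows "a = b" "q = q'"
proof -
  show "a = b" using arg_cong[OF assms(1), of "\<lambda>t. t mod m"] assms(2,3) by simp
  then show "q = q'" using assms by simp
qed

lemma inj_on_extend_bij_betw:
  assumes "finite A" "finite C" "card A = card C" "B \<subseteq> A" "inj_on g B" "g ` B \<subseteq> C"
  obtains h where "bij_betw h A C" "\<And>x. x \<in> B \<Longrightarrow> h x = g x"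
proof -
  have "card (A - B) = card (C - g ` B)"
    using assms by (simp add: card_Diff_subset finite_subset card_image)
  then obtain h where h: "bij_betw h (A - B) (C - g ` B)"
    using assms finite_same_card_bij by blast
  define h' where "h' x = (if x \<in> B then g x else h x)" for x
  have "bij_betw h' B (g ` B)"
    using assms(5) by (auto simp: bij_betw_def h'_def inj_on_def)
  moreover have "bij_betw h' (A - B) (C - g ` B)"
    using h by (rule bij_betw_cong[THEN iffD1, rotated]) (simp add: h'_def)
  ultimately have "bij_betw h' (B \<union> (A - B)) (g ` B \<union> (C - g ` B))"
    by (rule bij_betw_combine) auto
  then have "bij_betw h' A C"
    using assms(4,6) by (simp add: Un_absorb1)
  then show ?thesis by (rule that) (simp add: h'_def)
qed

section \<open>Labelings of the split graph\<close>

locale bipartite_decomposition =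
  fixes V X Y :: "'a set" and E E1 E2 :: "'a set set" and n :: nat
  assumes simple: "simple_graph V E"
    and bipartite: "bipartite_with V E X Y"
    and decomp: "E1 \<union> E2 = E" "E1 \<inter> E2 = {}"
begin

abbreviation "elements \<equiv> Inl ` V \<union> Inr ` E"
abbreviation "SV \<equiv> S2n_vertices n V X Y"
abbreviation "SE \<equiv> S2n_edges n E X Y E1 E2"

section \<open>Vertices and edges of the split graph\<close>

lemma parts: "X \<union> Y = V" "X \<inter> Y = {}"
  using bipartite by (auto simp: bipartite_with_def)

lemma edgeE:
  assumes "e \<in> E"
  obtains x y where "x \<in> X" "y \<in> Y" "x \<in> V" "y \<in> V" "x \<noteq> y" "e = {x, y}"
proof -
  obtain x y where "x \<in> X" "y \<in> Y" "e = {x, y}"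
    using assms bipartite unfolding bipartite_with_def by blast
  then show thesis using parts that by blast
qed

lemma finite_V: "finite V" and finite_E: "finite E"
  using simple simple_graph_finite_edges by (auto simp: simple_graph_def)

lemma SV_eq: "SV = V \<times> {0..n}"
proof -
  have "{0..n} = insert 0 {1..n}" by auto
  then show ?thesis using parts(1) by (auto simp: S2n_vertices_def)
qed

text \<open>Original edges are absorbed as copies of index 0, which leaves two uniform cases
  according to the endpoint that carries the index.\<close>

lemma SE_cases:
  assumes "e \<in> SE"
  obtains (left) x y k where "x \<in> X" "y \<in> Y" "k \<le> n" "{x, y} \<in> E1" "e = {(x, 0), (y, k)}"
    | (right) x y k where "x \<in> X" "y \<in> Y" "k \<le> n" "{x, y} \<in> E2" "e = {(x, k), (y, 0)}"
proof -
  consider (orig) e' where "e' \<in> E" "e = (\<lambda>v. (v, 0)) ` e'"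
    | (l) x y k where "x \<in> X" "y \<in> Y" "k \<le> n" "{x, y} \<in> E1" "e = {(x, 0), (y, k)}"
    | (r) x y k where "x \<in> X" "y \<in> Y" "k \<le> n" "{x, y} \<in> E2" "e = {(x, k), (y, 0)}"
    using assms unfolding S2n_edges_def by auto
  then show thesis
  proof cases
    case orig
    then obtain x y where "x \<in> X" "y \<in> Y" "e' = {x, y}" by (meson edgeE)
    then show thesis using orig decomp(1) left[of x y 0] right[of x y 0] by auto
  qed (use left right in blast)+
qed

lemma SE_left:
  assumes "x \<in> X" "y \<in> Y" "k \<le> n" "{x, y} \<in> E1"
  shows "{(x, 0), (y, k)} \<in> SE"
proof (cases "k = 0")
  case True
  have "(\<lambda>v. (v, 0::nat)) ` {x, y} \<in> SE"
    using assms decomp(1) unfolding S2n_edges_def by blast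
  then show ?thesis using True by simp
next
  case False
  then have "k \<in> {1..n}" using assms by simp
  then show ?thesis using assms unfolding S2n_edges_def by blast
qed

lemma SE_right:
  assumes "x \<in> X" "y \<in> Y" "k \<le> n" "{x, y} \<in> E2"
  shows "{(x, k), (y, 0)} \<in> SE"
proof (cases "k = 0")
  case True
  have "(\<lambda>v. (v, 0::nat)) ` {x, y} \<in> SE"
    using assms decomp(1) unfolding S2n_edges_def by blast
  then show ?thesis using True by simp
next
  case False
  then have "k \<in> {1..n}" using assms by simp
  then show ?thesis using assms unfolding S2n_edges_def by blast
qed

lemma simple_S: "simple_graph SV SE"
proof -
  have "\<exists>a b. a \<in> SV \<and> b \<in> SV \<and> a \<noteq> b \<and> e = {a, b}" if "e \<in> SE" for e
    using that
  proof (cases rule: SE_cases)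
    case (left x y k)
    then have "(x, 0) \<in> SV" "(y, k) \<in> SV" "x \<noteq> y" using parts by (auto simp: SV_eq)
    then show ?thesis using left by blast
  next
    case (right x y k)
    then have "(x, k) \<in> SV" "(y, 0) \<in> SV" "x \<noteq> y" using parts by (auto simp: SV_eq)
    then show ?thesis using right by blast
  qed
  then show ?thesis using finite_V by (simp add: simple_graph_def SV_eq)
qed

text \<open>The element of \<open>G\<close> and the copy index from which an element of \<open>S\<close> arises. An edge has at
  most one endpoint with nonzero index, so \<open>Max\<close> picks out the copy index.\<close>

fun origin :: "('a \<times> nat) + ('a \<times> nat) set \<Rightarrow> ('a + 'a set) \<times> nat" where
  "origin (Inl v) = (Inl (fst v), snd v)"
| "origin (Inr e) = (Inr (fst ` e), Max (snd ` e))"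

text \<open>An edge of \<open>G\<close> lies in exactly one of \<open>E1\<close> and
  \<open>E2\<close>, which decides the endpoint that carries the copy index; hence edge and index
  determine the copy.\<close>

lemma bij_betw_origin:
  "bij_betw origin (Inl ` SV \<union> Inr ` SE) (elements \<times> {0..n})"
proof -
  have "inj_on origin (Inr ` SE)"
  proof (rule inj_onI, clarify)
    fix e e' assume e: "e \<in> SE" "e' \<in> SE" and eq: "origin (Inr e) = origin (Inr e')"
    show "e = e'"
      using e(1)
    proof (cases rule: SE_cases)
      case l: (left x y k)
      show ?thesis
        using e(2)
      proof (cases rule: SE_cases)
        case (left x' y' k')
        then have "x = x'" "y = y'" "k = k'"
          using l eq parts(2) by (auto simp: doubleton_eq_iff)
        then show ?thesis using l left by simp
      next
        case (right x' y' k')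
        \<comment> \<open>Both copies would come from one edge of \<open>G\<close> lying in
          \<open>E1\<close> and in \<open>E2\<close>.\<close>
        then show ?thesis using l eq decomp(2) by auto
      qed
    next
      case r: (right x y k)
      show ?thesis
        using e(2)
      proof (cases rule: SE_cases)
        case (left x' y' k')
        then show ?thesis using r eq decomp(2) by auto
      next
        case (right x' y' k')
        then have "x = x'" "y = y'" "k = k'"
          using r eq parts(2) by (auto simp: doubleton_eq_iff)
        then show ?thesis using r right by simp
      qed
    qed
  qed
  moreover have "origin ` Inr ` SE = Inr ` E \<times> {0..n}"
  proof (intro equalityI subsetI)
    fix p assume "p \<in> origin ` Inr ` SE"
    then obtain e where "e \<in> SE" "p = origin (Inr e)" by blast
    then show "p \<in> Inr ` E \<times> {0..n}"
      using decomp(1) by (cases rule: SE_cases) auto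
  next
    fix p :: "('a + 'a set) \<times> nat" assume "p \<in> Inr ` E \<times> {0..n}"
    then obtain e k where p: "e \<in> E" "k \<le> n" "p = (Inr e, k)" by auto
    then obtain x y where xy: "x \<in> X" "y \<in> Y" "e = {x, y}" by (meson edgeE)
    have "p = origin (Inr {(x, 0), (y, k)})" "p = origin (Inr {(x, k), (y, 0)})"
      using p xy by simp_all
    moreover have "{(x, 0), (y, k)} \<in> SE \<or> {(x, k), (y, 0)} \<in> SE"
      using p xy decomp(1) SE_left SE_right by blast
    ultimately show "p \<in> origin ` Inr ` SE" by blast
  qed
  ultimately have "bij_betw origin (Inr ` SE) (Inr ` E \<times> {0..n})"
    by (simp add: bij_betw_def)
  moreover have "bij_betw origin (Inl ` SV) (Inl ` V \<times> {0..n})"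
    unfolding SV_eq by (force simp: bij_betw_def inj_on_def image_iff)
  ultimately show ?thesis
    unfolding Sigma_Un_distrib1 by (intro bij_betw_combine) auto
qed

section \<open>Transfer of labelings to the split graph\<close>

lemma card_elements_times: "card (elements \<times> {0..n}) = (n + 1) * (card V + card E)"
  by (simp add: card_cartesian_product card_graph_elements finite_V finite_E)

lemma card_S: "card SV + card SE = (n + 1) * (card V + card E)"
proof -
  have "card SV + card SE = card (Inl ` SV \<union> Inr ` SE)"
    using simple_S by (simp add: card_graph_elements simple_graph_finite_edges simple_graph_def)
  then show ?thesis
    using bij_betw_same_card[OF bij_betw_origin] card_elements_times by simp
qed

text \<open>Pulls a labeling of pairs back along \<open>origin\<close>. The condition
  \<open>sum\<close> ranges over both orders of the endpoints, so it serves copies of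
  \<open>E1\<close>, where the end in \<open>Y\<close> carries the index, and copies of
  \<open>E2\<close>, where the end in \<open>X\<close> does.\<close>

lemma valences_SI:
  assumes ne: "E \<noteq> {}"
    and bij: "bij_betw \<phi> (elements \<times> {0..n}) {1..(n + 1) * (card V + card E)}"
    and sum: "\<And>x y k. \<lbrakk>{x, y} \<in> E; x \<noteq> y; k \<le> n\<rbrakk>
      \<Longrightarrow> \<phi> (Inl x, 0) + \<phi> (Inr {x, y}, k) + \<phi> (Inl y, k) = c"
  shows "c \<in> valences SV SE"
proof -
  define F where "F = \<phi> \<circ> origin"
  have "bij_betw F (Inl ` SV \<union> Inr ` SE) {1..card SV + card SE}"
    unfolding F_def card_S by (rule bij_betw_trans[OF bij_betw_origin bij])
  moreover have "SE \<noteq> {}"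
    using ne by (auto simp: S2n_edges_def)
  moreover have "F (Inl a) + F (Inr e) + F (Inl b) = c"
    if "e \<in> SE" "e = {a, b}" "a \<noteq> b" for e a b
    using that(1)
  proof (cases rule: SE_cases)
    case (left x y k)
    then have "\<phi> (Inl x, 0) + \<phi> (Inr {x, y}, k) + \<phi> (Inl y, k) = c"
      using sum parts(2) decomp(1) by auto
    then show ?thesis
      using left that by (auto simp: F_def doubleton_eq_iff insert_commute)
  next
    case (right x y k)
    then have "\<phi> (Inl y, 0) + \<phi> (Inr {y, x}, k) + \<phi> (Inl x, k) = c"
      using sum[of y x k] parts(2) decomp(1) by (auto simp: insert_commute)
    then show ?thesis
      using right that by (auto simp: F_def doubleton_eq_iff insert_commute)
  qed
  ultimately have "edge_magic_labeling SV SE F c"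
    by (auto simp: edge_magic_labeling_def)
  then show ?thesis by (auto simp: valences_def)
qed

section \<open>Valences from block labelings\<close>

lemma valences_S_block:
  assumes k: "k \<in> valences V E" and r: "r \<le> n"
    and c: "c + 2 * n = (n + 1) * k + r"
  shows "c \<in> valences SV SE"
proof -
  obtain f where f: "edge_magic_labeling V E f k"
    using k by (auto simp: valences_def)
  \<comment> \<open>The transposition of 0 and \<open>r\<close>: it moves the original vertices to
    position \<open>r\<close>.\<close>
  define \<sigma> where "\<sigma> i = (if i = 0 then r else if i = r then 0 else i)" for i :: nat
  have \<sigma>_le: "\<sigma> i \<le> n" if "i \<le> n" for i using that r by (simp add: \<sigma>_def)
  have \<sigma>_inj: "\<sigma> i = \<sigma> j \<longleftrightarrow> i = j" for i j by (auto simp: \<sigma>_def)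
  \<comment> \<open>A copied vertex and an edge of the same index have positions adding up to
    \<open>n\<close>, independently of that index.\<close>
  define \<pi> where "\<pi> u i = (case u of Inl _ \<Rightarrow> \<sigma> i | Inr _ \<Rightarrow> n - \<sigma> i)"
    for u :: "'a + 'a set" and i
  define \<phi> where "\<phi> = (\<lambda>(u, i). (n + 1) * (f u - 1) + \<pi> u i + 1)"
  have \<pi>_le: "\<pi> u i \<le> n" if "i \<le> n" for u i
    using \<sigma>_le[OF that] by (simp add: \<pi>_def split: sum.split)
  have \<pi>_inj: "i = j" if "\<pi> u i = \<pi> u j" "i \<le> n" "j \<le> n" for u i j
    using that \<sigma>_le[of i] \<sigma>_le[of j] \<sigma>_inj[of i j]
    by (auto simp: \<pi>_def split: sum.splits)
  have fpos: "1 \<le> f u" and fle: "f u \<le> card V + card E" if "u \<in> elements" for u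
    using edge_magic_labeling_range[OF f that] by simp_all
  have finj: "inj_on f elements"
    using f by (simp add: edge_magic_labeling_def bij_betw_def)
  have "inj_on \<phi> (elements \<times> {0..n})"
  proof (rule inj_onI)
    fix p p' assume p: "p \<in> elements \<times> {0..n}" "p' \<in> elements \<times> {0..n}" "\<phi> p = \<phi> p'"
    obtain u i u' i' where [simp]: "p = (u, i)" "p' = (u', i')" by fastforce
    have u: "u \<in> elements" "u' \<in> elements" "i \<le> n" "i' \<le> n"
      using p by simp_all
    have eq: "(n + 1) * (f u - 1) + \<pi> u i = (n + 1) * (f u' - 1) + \<pi> u' i'"
      using p(3) by (simp add: \<phi>_def)
    have lt: "\<pi> u i < n + 1" "\<pi> u' i' < n + 1"
      using \<pi>_le u by (simp_all add: less_Suc_eq_le)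
    have "f u - 1 = f u' - 1"
      by (rule quotient_remainder_unique(2)[OF _ lt]) (use eq in simp)
    then have "f u = f u'" using fpos[OF u(1)] fpos[OF u(2)] by linarith
    then have [simp]: "u' = u" using inj_onD[OF finj _ u(1,2)] by simp
    have "\<pi> u i = \<pi> u i'" using eq by simp
    then show "p = p'" using \<pi>_inj u(3,4) by simp
  qed
  moreover have "\<phi> ` (elements \<times> {0..n}) \<subseteq> {1..(n + 1) * (card V + card E)}"
  proof clarify
    fix u i assume u: "u \<in> elements" "i \<in> {0..n}"
    have "\<phi> (u, i) \<le> (n + 1) * (f u - 1) + (n + 1)"
      using \<pi>_le[of i u] u(2) by (simp add: \<phi>_def)
    also have "\<dots> = (n + 1) * f u"
      using fpos[OF u(1)] by (cases "f u") simp_all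
    also have "\<dots> \<le> (n + 1) * (card V + card E)"
      using fle[OF u(1)] by (rule mult_le_mono2)
    finally show "\<phi> (u, i) \<in> {1..(n + 1) * (card V + card E)}" by (simp add: \<phi>_def)
  qed
  ultimately have bij: "bij_betw \<phi> (elements \<times> {0..n}) {1..(n + 1) * (card V + card E)}"
    unfolding bij_betw_def using card_elements_times
    by (simp add: card_image card_subset_eq)
  show ?thesis
  proof (rule valences_SI[OF _ bij])
    show "E \<noteq> {}" using f by (simp add: edge_magic_labeling_def)
    fix x y i assume e: "{x, y} \<in> E" "x \<noteq> y" "i \<le> n"
    have el: "Inl x \<in> elements" "Inl y \<in> elements" "Inr {x, y} \<in> elements"
      using edgeE[OF e(1)] e(1) by (auto simp: doubleton_eq_iff)
    have pos: "f (Inl x) \<ge> 1" "f (Inl y) \<ge> 1" "f (Inr {x, y}) \<ge> 1"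
      using fpos el by blast+
    \<comment> \<open>Zero-based labels add up to \<open>k - 3\<close>. Blocks contribute
      \<open>(n + 1) * (k - 3)\<close>, positions \<open>r + n\<close>, and the shifts back to
      one-based labels 3, which gives \<open>(n + 1) * k - 2 * n + r\<close>.\<close>
    define a b d where "a = f (Inl x) - 1" and "b = f (Inl y) - 1" and "d = f (Inr {x, y}) - 1"
    have "f (Inl x) + f (Inr {x, y}) + f (Inl y) = k"
      using f e by (auto simp: edge_magic_labeling_def)
    then have "k = a + b + d + 3" using pos by (simp add: a_def b_def d_def)
    moreover have "\<phi> (Inl x, 0) = (n + 1) * a + r + 1" "\<phi> (Inl y, i) = (n + 1) * b + \<sigma> i + 1"
      "\<phi> (Inr {x, y}, i) = (n + 1) * d + (n - \<sigma> i) + 1"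
      by (simp_all add: \<phi>_def \<pi>_def \<sigma>_def a_def b_def d_def)
    ultimately show "\<phi> (Inl x, 0) + \<phi> (Inr {x, y}, i) + \<phi> (Inl y, i) = c"
      using c \<sigma>_le[OF e(3)] by (simp add: algebra_simps)
  qed
qed

section \<open>A valence below the block range\<close>

lemma valences_S_low:
  assumes k: "k \<in> valences V E" and n: "n \<ge> 1"
  obtains c where "c \<in> valences SV SE" "c + 2 * n < (n + 1) * k"
proof -
  obtain f where f: "edge_magic_labeling V E f k"
    using k by (auto simp: valences_def)
  \<comment> \<open>Isolated vertices are left out because their labels are not bounded in terms of
    \<open>k\<close>.\<close>
  define B where "B = Inl ` \<Union>E \<union> Inr ` E"
  define M where "M = Max (f ` B)"
  have B: "B \<subseteq> elements"
    unfolding B_def by (auto elim!: edgeE)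
  then have finB: "finite B"
    using finite_V finite_E by (auto intro: finite_subset)
  have ne: "E \<noteq> {}" using f by (simp add: edge_magic_labeling_def)
  then have "f ` B \<noteq> {}" by (auto simp: B_def)
  then have "M \<in> f ` B" using finB by (simp add: M_def)
  then obtain m where m: "m \<in> B" "f m = M" by blast
  have le_M: "f u \<le> M" if "u \<in> B" for u using that finB by (simp add: M_def)
  have fpos: "1 \<le> f u" if "u \<in> B" for u
    using edge_magic_labeling_range(1)[OF f] that B by blast
  have M_le: "M \<le> card V + card E"
    using m B edge_magic_labeling_range(2)[OF f] by blast
  have finj: "inj_on f B"
    using f B by (auto simp: edge_magic_labeling_def bij_betw_def intro: inj_on_subset)
  \<comment> \<open>\<open>M\<close> is one of three distinct positive labels with sum
    \<open>k\<close>; the other two add up to at least 1 + 2.\<close>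
  have M3: "M + 3 \<le> k"
  proof -
    obtain e where e: "e \<in> E" "m = Inr e \<or> (\<exists>v\<in>e. m = Inl v)"
      using m(1) by (auto simp: B_def)
    obtain x y where xy: "x \<noteq> y" "e = {x, y}" using e(1) by (meson edgeE)
    have el: "Inl x \<in> B" "Inl y \<in> B" "Inr e \<in> B" using e(1) xy by (auto simp: B_def)
    have "f (Inl x) \<noteq> f (Inl y)" "f (Inl x) \<noteq> f (Inr e)" "f (Inl y) \<noteq> f (Inr e)"
      using el xy(1) finj by (auto dest: inj_onD)
    moreover have "f (Inl x) + f (Inr e) + f (Inl y) = k"
      using f e(1) xy by (auto simp: edge_magic_labeling_def)
    moreover have "M = f (Inl x) \<or> M = f (Inl y) \<or> M = f (Inr e)"
      using m(2) e(2) xy by auto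
    ultimately show ?thesis using fpos[OF el(1)] fpos[OF el(2)] fpos[OF el(3)] by linarith
  qed
  define \<pi> where "\<pi> u i = (case u of Inl _ \<Rightarrow> i | Inr _ \<Rightarrow> n - i)" for u :: "'a + 'a set" and i
  define g where "g = (\<lambda>(u, i). f u + M * \<pi> u i)"
  have "inj_on g (B \<times> {0..n})"
  proof (rule inj_onI)
    fix p p' assume p: "p \<in> B \<times> {0..n}" "p' \<in> B \<times> {0..n}" "g p = g p'"
    obtain u i u' i' where [simp]: "p = (u, i)" "p' = (u', i')" by fastforce
    have u: "u \<in> B" "u' \<in> B" "i \<le> n" "i' \<le> n" using p by simp_all
    \<comment> \<open>Lowering labels by 1 turns the range 1 to \<open>M\<close> into residues below
      \<open>M\<close>.\<close>
    have "(f u - 1) + M * \<pi> u i = (f u' - 1) + M * \<pi> u' i'"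
      using p(3) fpos[OF u(1)] fpos[OF u(2)] by (simp add: g_def)
    moreover have "f u - 1 < M" "f u' - 1 < M"
      using fpos[OF u(1)] fpos[OF u(2)] le_M[OF u(1)] le_M[OF u(2)] by linarith+
    ultimately have eq: "f u - 1 = f u' - 1" "\<pi> u i = \<pi> u' i'"
      by (rule quotient_remainder_unique)+
    then have "f u = f u'" using fpos[OF u(1)] fpos[OF u(2)] by linarith
    then have "u = u'" using inj_onD[OF finj _ u(1,2)] by simp
    then show "p = p'" using eq(2) u(3,4) by (auto simp: \<pi>_def split: sum.splits)
  qed
  moreover have "g ` (B \<times> {0..n}) \<subseteq> {1..(n + 1) * (card V + card E)}"
  proof clarify
    fix u i assume u: "u \<in> B" "i \<in> {0..n}"
    have "\<pi> u i \<le> n" using u(2) by (simp add: \<pi>_def split: sum.split)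
    then have "g (u, i) \<le> M + M * n"
      using le_M[OF u(1)] by (simp add: g_def add_mono)
    also have "\<dots> \<le> (n + 1) * (card V + card E)"
      using mult_le_mono2[OF M_le, of "n + 1"] by (simp add: algebra_simps)
    finally show "g (u, i) \<in> {1..(n + 1) * (card V + card E)}"
      using fpos[OF u(1)] by (simp add: g_def)
  qed
  moreover have "finite (elements \<times> {0..n})" using finite_V finite_E by simp
  moreover have "B \<times> {0..n} \<subseteq> elements \<times> {0..n}" using B by blast
  moreover have "card (elements \<times> {0..n}) = card {1..(n + 1) * (card V + card E)}"
    using card_elements_times by simp
  ultimately obtain \<phi> where bij: "bij_betw \<phi> (elements \<times> {0..n}) {1..(n + 1) * (card V + card E)}"
    and \<phi>: "\<And>p. p \<in> B \<times> {0..n} \<Longrightarrow> \<phi> p = g p"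
    by (metis inj_on_extend_bij_betw finite_atLeastAtMost)
  have "k + M * n \<in> valences SV SE"
  proof (rule valences_SI[OF ne bij])
    fix x y i assume e: "{x, y} \<in> E" "x \<noteq> y" "i \<le> n"
    have "Inl x \<in> B" "Inl y \<in> B" "Inr {x, y} \<in> B" using e(1) by (auto simp: B_def)
    then have "\<phi> (Inl x, 0) = f (Inl x)" "\<phi> (Inl y, i) = f (Inl y) + M * i"
      "\<phi> (Inr {x, y}, i) = f (Inr {x, y}) + M * (n - i)"
      using e(3) by (simp_all add: \<phi> g_def \<pi>_def)
    moreover have "f (Inl x) + f (Inr {x, y}) + f (Inl y) = k"
      using f e by (auto simp: edge_magic_labeling_def)
    moreover have "M * (n - i) + M * i = M * n"
      using e(3) by (simp flip: distrib_left)
    ultimately show "\<phi> (Inl x, 0) + \<phi> (Inr {x, y}, i) + \<phi> (Inl y, i) = k + M * n"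
      by linarith
  qed
  \<comment> \<open>From \<open>n * (M + 3) \<le> n * k\<close> the left side is at most
    \<open>(n + 1) * k - n\<close>, and \<open>n\<close> is positive.\<close>
  moreover have "k + M * n + 2 * n < (n + 1) * k"
    using mult_le_mono2[OF M3, of n] n by (simp add: algebra_simps)
  ultimately show thesis by (rule that)
qed

section \<open>Counting the valences\<close>

lemma card_valences_S_ge:
  assumes em: "edge_magic V E" and n: "n \<ge> 1"
  shows "card (valences SV SE) \<ge> (n + 1) * card (valences V E) + 2"
proof -
  let ?N = "card V + card E"
  define k0 where "k0 = Min (valences V E)"
  have fin: "finite (valences V E)" using simple by (rule finite_valences)
  have k0: "k0 \<in> valences V E"
    using fin em by (simp add: k0_def edge_magic_def)
  have k0_le: "k0 \<le> k" if "k \<in> valences V E" for k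
    using that fin by (simp add: k0_def)
  obtain c0 where c0: "c0 \<in> valences SV SE" "c0 + 2 * n < (n + 1) * k0"
    using valences_S_low[OF k0 n] .
  have c0_le: "c0 \<le> 3 * ((n + 1) * ?N)"
    using valences_le[OF simple_S c0(1)] card_S by simp
  define c1 where "c1 = 3 * ((n + 1) * ?N + 1) - c0"
  have c01: "c0 + c1 = 3 * ((n + 1) * ?N) + 3"
    using c0_le by (simp add: c1_def)
  have c1: "c1 \<in> valences SV SE"
    using valences_complement[OF simple_S c0(1)] card_S by (simp add: c1_def)
  define h where "h = (\<lambda>(k, r). (n + 1) * k + r - 2 * n)"
  define A where "A = h ` (valences V E \<times> {0..n})"
  \<comment> \<open>The subtraction in \<open>h\<close> is exact, since \<open>2 * n\<close> is
    below \<open>(n + 1) * k0\<close>.\<close>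
  have h_eq: "h (k, r) + 2 * n = (n + 1) * k + r" if "k \<in> valences V E" for k r
  proof -
    have "(n + 1) * k0 \<le> (n + 1) * k" using k0_le[OF that] by (rule mult_le_mono2)
    then show ?thesis using c0(2) unfolding h_def by simp
  qed
  have "A \<subseteq> valences SV SE"
    unfolding A_def using valences_S_block h_eq by auto
  moreover have "card A = (n + 1) * card (valences V E)"
  proof -
    have "inj_on h (valences V E \<times> {0..n})"
    proof (rule inj_onI, clarify)
      fix k r k' r'
      assume k: "k \<in> valences V E" "k' \<in> valences V E" "r \<in> {0..n}" "r' \<in> {0..n}"
        and "h (k, r) = h (k', r')"
      then have eq: "(n + 1) * k + r = (n + 1) * k' + r'" using h_eq by metis
      moreover have "r < n + 1" "r' < n + 1" using k by simp_all
      ultimately have "k = k'"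
        using quotient_remainder_unique(2)[of r "n + 1" k r' k'] by (simp add: add.commute)
      then show "k = k' \<and> r = r'" using eq by simp
    qed
    then show ?thesis by (simp add: A_def card_image card_cartesian_product)
  qed
  moreover have bounds: "c0 < a \<and> a < c1" if in_A: "a \<in> A" for a
  proof -
    obtain k r where a: "k \<in> valences V E" "r \<le> n" "a = h (k, r)"
      using in_A by (auto simp: A_def)
    \<comment> \<open>The complement of \<open>k\<close> is again a valence of \<open>G\<close>,
      hence at least \<open>k0\<close>. Scaled by \<open>n + 1\<close>, this bounds
      \<open>a + c0\<close> strictly below \<open>c0 + c1\<close>.\<close>
    have "k0 \<le> 3 * (?N + 1) - k"
      using valences_complement[OF simple a(1)] k0_le by blast
    then have "k + k0 \<le> 3 * (?N + 1)"
      using valences_le[OF simple a(1)] by simp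
    then have "(n + 1) * (k + k0) \<le> (n + 1) * (3 * (?N + 1))" by (rule mult_le_mono2)
    then have "(n + 1) * k + (n + 1) * k0 \<le> 3 * ((n + 1) * ?N) + 3 * n + 3"
      by (simp add: algebra_simps)
    moreover have "(n + 1) * k0 \<le> (n + 1) * k" using k0_le[OF a(1)] by (rule mult_le_mono2)
    ultimately show ?thesis
      using h_eq[OF a(1), of r] a(2,3) c0(2) c01 by linarith
  qed
  moreover have "c0 < c1"
  proof -
    \<comment> \<open>Any member of \<open>A\<close> separates \<open>c0\<close> from
      \<open>c1\<close>.\<close>
    have "h (k0, 0) \<in> A" using k0 by (auto simp: A_def)
    then show ?thesis using bounds by force
  qed
  moreover have "finite A" using fin by (simp add: A_def)
  ultimately have "card (insert c0 (insert c1 A)) = (n + 1) * card (valences V E) + 2"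
    "insert c0 (insert c1 A) \<subseteq> valences SV SE"
    using c0(1) c1 by (auto simp: card_insert_if)
  then show ?thesis
    using card_mono[OF finite_valences[OF simple_S]] by metis
qed

end

theorem mainTheorem11:
  fixes V X Y :: "'a set" and E E1 E2 :: "'a set set" and n :: nat
  assumes "simple_graph V E"
    and "bipartite_with V E X Y"
    and "edge_magic V E"
    and "E1 \<subseteq> E" and "E2 \<subseteq> E" and "E1 \<union> E2 = E" and "E1 \<inter> E2 = {}"
    and "n \<ge> 1"
  shows "card (valences (S2n_vertices n V X Y) (S2n_edges n E X Y E1 E2))
           \<ge> (n + 1) * card (valences V E) + 2"
proof -
  interpret bipartite_decomposition V X Y E E1 E2 n
    using assms by unfold_locales auto
  show ?thesis using assms(3,8) by (rule card_valences_S_ge)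
qed

end
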